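(* Every distributional problem that under the standard uniform distribution is in $\mathrm{AvgP}$ has a frequently self-knowingly correct polynomial-time algorithm. That is, if $f:\Sigma^*\to\Sigma^*$ and $(f,\hat\mu)\in\mathrm{AvgP}$, where $\hat\mu$ is the standard uniform distribution, then there is a polynomial-time algorithm that is frequently self-knowingly correct for $f$.
   Context: Let $\Sigma=\{0,1\}$. A distribution function $\mu:\Sigma^*\to[0,1]$ is a nondecreasing function (with respect to the length-lexicographic order on strings) converging to one; its density $\mu'(x)$ is the weight it assigns to the string $x$, i.e., $\mu'(x)=\mu(x)-\mu(x-1)$, where $x-1$ is the predecessor of $x$ (for the first string, $\mu'$ equals $\mu$). A distributional (search) problem is a pair $(f,\mu)$ with $f:\Sigma^*\to\Sigma^*$ a function and $\mu$ a distribution function (decision problems are defined analogously). A function $t:\Sigma^*\to\mathbb{N}$ is polynomial on the average with respect to $\mu$ if there is a constant $\epsilon>0$ such that $\sum_{x\in\Sigma^*}\mu'(x)\cdot\frac{t(x)^\epsilon}{|x|}<\infty$. $\mathrm{AvgP}$ is the class of all distributional problems $(f,\mu)$ for which there is an algorithm computing $f$ whose running time is polynomial on the average with respect to $\mu$. The standard uniform distribution $\hat\mu$ on $\Sigma^*$ has density $\hat\mu'(x)=\frac{1}{|x|(|x|+1)2^{|x|}}$ for nonempty $x$; the empty string has weight zero and is excluded. For a function $f:S\to T$, an algorithm $\mathcal{A}:S\to T\times\{\text{"definitely"},\text{"maybe"}\}$ is self-knowingly correct for $f$ if, for each $s\in S$ and $t\in T$, whenever $\mathcal{A}$ on input $s$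 outputs $(t,\text{"definitely"})$ then $f(s)=t$. An algorithm $\mathcal{A}$ that is self-knowingly correct for $g:\Sigma^*\to T$ is frequently self-knowingly correct for $g$ if $$\lim_{n\to\infty}\frac{\|\{x\in\Sigma^n\mid \mathcal{A}(x)\in T\times\{\text{"maybe"}\}\}\|}{\|\Sigma^n\|}=0.$$ *)

theory Defs
  imports "HOL-Analysis.Analysis" "HOL-Library.List_Lenlexorder"
begin

section \<open>Deterministic multi-tape Turing machines\<close>

text \<open>
  The alphabet is \<open>{..<symbs M}\<close>, where 0 is the blank and 1, 2 stand for the bits 0, 1;
  the states are \<open>{..<states M}\<close>. Tapes are infinite in both directions and are
  represented by the head position and the cell contents. The transition function receives the
  current state and the scanned symbols, one per tape, and returns the new state and, for each
  tape, the symbol to be written and the head move.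
\<close>

datatype move = MoveLeft | Stay | MoveRight

record machine =
  tapes :: nat
  symbs :: nat
  states :: nat
  start :: nat
  final :: nat
  delta :: "nat \<Rightarrow> nat list \<Rightarrow> nat \<times> (nat \<times> move) list"

type_synonym tape = "int \<times> (int \<Rightarrow> nat)"
type_synonym config = "nat \<times> tape list"

definition wf_machine :: "machine \<Rightarrow> bool" where
  "wf_machine M \<longleftrightarrow>
     tapes M \<ge> 1 \<and> symbs M \<ge> 3 \<and> start M < states M \<and> final M < states M \<and>
     (\<forall>q < states M. \<forall>ss. q \<noteq> final M \<longrightarrow> length ss = tapes M \<longrightarrow> set ss \<subseteq> {..<symbs M} \<longrightarrow>
        fst (delta M q ss) < states M \<and>
        length (snd (delta M q ss)) = tapes M \<and>
        (\<forall>a \<in> set (snd (delta M q ss)). fst a < symbs M))"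

fun offset :: "move \<Rightarrow> int" where
  "offset MoveLeft = -1"
| "offset Stay = 0"
| "offset MoveRight = 1"

definition scan :: "tape \<Rightarrow> nat" where
  "scan tp = snd tp (fst tp)"

definition act :: "nat \<times> move \<Rightarrow> tape \<Rightarrow> tape" where
  "act a tp = (fst tp + offset (snd a), (snd tp)(fst tp := fst a))"

definition step :: "machine \<Rightarrow> config \<Rightarrow> config" where
  "step M c =
     (if fst c = final M then c
      else let (q, as) = delta M (fst c) (map scan (snd c)) in (q, map2 act as (snd c)))"

definition bit_symb :: "bool \<Rightarrow> nat" where
  "bit_symb b = (if b then 2 else 1)"

definition input_tape :: "bool list \<Rightarrow> tape" where
  "input_tape x =
     (0, \<lambda>i. if 0 \<le> i \<and> i < int (length x) then bit_symb (x ! nat i) else 0)"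

definition init :: "machine \<Rightarrow> bool list \<Rightarrow> config" where
  "init M x = (start M, input_tape x # replicate (tapes M - 1) (0, \<lambda>_. 0))"

definition run :: "machine \<Rightarrow> bool list \<Rightarrow> nat \<Rightarrow> config" where
  "run M x n = (step M ^^ n) (init M x)"

definition halted :: "machine \<Rightarrow> config \<Rightarrow> bool" where
  "halted M c \<longleftrightarrow> fst c = final M"

definition time :: "machine \<Rightarrow> bool list \<Rightarrow> nat" where
  "time M x = (LEAST n. halted M (run M x n))"

text \<open>
  The output is the word on the first tape that begins at the scanned cell and extends up to the
  next blank.
\<close>

definition has_output :: "config \<Rightarrow> bool list \<Rightarrow> bool" where
  "has_output c y \<longleftrightarrow>
     (let (h, w) = hd (snd c) in
        (\<forall>i < length y. w (h + int i) = bit_symb (y ! i)) \<and> w (h + int (length y)) = 0)"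

definition computes :: "machine \<Rightarrow> (bool list \<Rightarrow> bool list) \<Rightarrow> bool" where
  "computes M f \<longleftrightarrow>
     wf_machine M \<and>
     (\<forall>x. (\<exists>n. halted M (run M x n)) \<and> has_output (run M x (time M x)) (f x))"

definition poly_time :: "machine \<Rightarrow> bool" where
  "poly_time M \<longleftrightarrow> (\<exists>c k. \<forall>x. time M x \<le> c * length x ^ k + c)"


section \<open>Distributional problems\<close>

text \<open>
  The order on strings is the length-lexicographic one provided by
  \<^theory>\<open>HOL-Library.List_Lenlexorder\<close>.
\<close>

definition distribution :: "(bool list \<Rightarrow> real) \<Rightarrow> bool" where
  "distribution \<mu> \<longleftrightarrow> range \<mu> \<subseteq> {0..1} \<and> mono \<mu> \<and> (\<mu> \<longlongrightarrow> 1) at_top"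

definition pred_string :: "bool list \<Rightarrow> bool list" where
  "pred_string x = Max {y. y < x}"

definition density :: "(bool list \<Rightarrow> real) \<Rightarrow> bool list \<Rightarrow> real" where
  "density \<mu> x = (if x = [] then \<mu> [] else \<mu> x - \<mu> (pred_string x))"

text \<open>
  The empty string is left out of the sum, since the quotient is undefined for \<open>|x| = 0\<close>. As all
  terms are nonnegative, summability means that the sum is finite.
\<close>

definition poly_on_average :: "(bool list \<Rightarrow> nat) \<Rightarrow> (bool list \<Rightarrow> real) \<Rightarrow> bool" where
  "poly_on_average t \<mu> \<longleftrightarrow>
     (\<exists>\<epsilon> > 0. (\<lambda>x. density \<mu> x * (real (t x) powr \<epsilon> / real (length x))) summable_on {x. x \<noteq> []})"

definition AvgP :: "((bool list \<Rightarrow> bool list) \<times> (bool list \<Rightarrow> real)) set" where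
  "AvgP = {(f, \<mu>). distribution \<mu> \<and> (\<exists>M. computes M f \<and> poly_on_average (time M) \<mu>)}"

definition std_uniform :: "bool list \<Rightarrow> real" where
  "std_uniform x =
     (\<Sum>y \<in> {..x} - {[]}. 1 / (real (length y) * (real (length y) + 1) * 2 ^ length y))"

lemma finite_atMost_string: "finite {..x :: bool list}"
proof (rule finite_subset)
  show "{..x} \<subseteq> {y. set y \<subseteq> UNIV \<and> length y \<le> length x}"
    by (auto simp: list_le_def list_less_def lenlex_conv)
  show "finite {y :: bool list. set y \<subseteq> UNIV \<and> length y \<le> length x}"
    by (rule finite_lists_length_le) simp
qed

lemma density_std_uniform_Nil: "density std_uniform [] = 0"
proof -
  have "{..[] :: bool list} - {[]} = {}"
    by auto
  then show ?thesis
    by (simp only: density_def std_uniform_def sum.empty) simp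
qed

lemma density_std_uniform:
  assumes "x \<noteq> []"
  shows "density std_uniform x = 1 / (real (length x) * (real (length x) + 1) * 2 ^ length x)"
proof -
  have fin: "finite {y. y < x}"
    by (rule finite_subset[OF _ finite_atMost_string[of x]]) auto
  have "[] < x"
    using assms by (cases x) simp_all
  then have ne: "{y. y < x} \<noteq> {}"
    by blast
  have lt: "pred_string x < x"
    using Max_in[OF fin ne] by (simp add: pred_string_def)
  have le: "y \<le> pred_string x" if "y < x" for y
    using Max_ge[OF fin] that by (simp add: pred_string_def)
  have "{..x} - {[]} = insert x ({..pred_string x} - {[]})"
  proof (rule set_eqI)
    fix y
    show "y \<in> {..x} - {[]} \<longleftrightarrow> y \<in> insert x ({..pred_string x} - {[]})"
      using assms lt le[of y] by (cases "y = x") (auto dest: order.strict_trans1)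
  qed
  moreover have "x \<notin> {..pred_string x}"
    using lt by auto
  ultimately show ?thesis
    using assms finite_atMost_string[of "pred_string x"]
    by (simp add: density_def std_uniform_def)
qed

lemma sum_std_uniform_length_le:
  "(\<Sum>y \<in> {y :: bool list. length y \<le> n \<and> y \<noteq> []}.
      1 / (real (length y) * (real (length y) + 1) * 2 ^ length y)) = 1 - 1 / (real n + 1)"
proof (induction n)
  case 0
  have "{y :: bool list. length y \<le> 0 \<and> y \<noteq> []} = {}"
    by auto
  then show ?case
    by (simp only: sum.empty) simp
next
  case (Suc n)
  have fin: "finite {y :: bool list. length y = m}" "finite {y :: bool list. length y \<le> m}" for m
    using finite_lists_length_eq[of "UNIV :: bool set" m]
      finite_lists_length_le[of "UNIV :: bool set" m] by auto
  have card: "card {y :: bool list. length y = m} = 2 ^ m" for m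
    using card_lists_length_eq[of "UNIV :: bool set" m] by simp
  have split: "{y :: bool list. length y \<le> Suc n \<and> y \<noteq> []} =
      {y. length y \<le> n \<and> y \<noteq> []} \<union> {y. length y = Suc n}"
    by auto
  have "(\<Sum>y\<in>{y :: bool list. length y = Suc n}.
      1 / (real (length y) * (real (length y) + 1) * 2 ^ length y)) =
      (\<Sum>y\<in>{y :: bool list. length y = Suc n}.
      1 / (real (Suc n) * (real (Suc n) + 1) * 2 ^ Suc n))"
    by (rule sum.cong) auto
  also have "\<dots> = 1 / (real (Suc n) * (real (Suc n) + 1))"
    by (simp add: card del: power_Suc of_nat_Suc)
  finally have *: "(\<Sum>y\<in>{y :: bool list. length y = Suc n}.
      1 / (real (length y) * (real (length y) + 1) * 2 ^ length y)) =
      1 / (real (Suc n) * (real (Suc n) + 1))" .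
  have "(\<Sum>y | length y \<le> Suc n \<and> y \<noteq> [].
      1 / (real (length (y :: bool list)) * (real (length y) + 1) * 2 ^ length y)) =
      (1 - 1 / (real n + 1)) + 1 / (real (Suc n) * (real (Suc n) + 1))"
    unfolding split
  proof (subst sum.union_disjoint)
    show "finite {y :: bool list. length y \<le> n \<and> y \<noteq> []}"
      by (rule finite_subset[OF _ fin(2)[of n]]) auto
    show "finite {y :: bool list. length y = Suc n}"
      by (rule fin(1))
    show "{y :: bool list. length y \<le> n \<and> y \<noteq> []} \<inter> {y. length y = Suc n} = {}"
      by auto
  qed (simp only: Suc.IH *)
  also have "\<dots> = 1 - 1 / (real (Suc n) + 1)"
    by (simp add: divide_simps add_nonneg_eq_0_iff) (simp add: algebra_simps)
  finally show ?case .
qed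

lemma distribution_std_uniform: "distribution std_uniform"
proof -
  let ?w = "\<lambda>y :: bool list. 1 / (real (length y) * (real (length y) + 1) * 2 ^ length y)"
  have finn: "finite {y :: bool list. length y \<le> n \<and> y \<noteq> []}" for n
    by (rule finite_subset[OF _ finite_lists_length_le[of "UNIV :: bool set" n]]) auto
  have up: "std_uniform x \<le> 1" for x
  proof -
    have "std_uniform x \<le> (\<Sum>y | length y \<le> length x \<and> y \<noteq> []. ?w y)"
      unfolding std_uniform_def
      by (rule sum_mono2[OF finn])
         (auto simp: list_le_def list_less_def lenlex_conv)
    also have "\<dots> \<le> 1"
      by (subst sum_std_uniform_length_le) simp
    finally show ?thesis .
  qed
  have low: "0 \<le> std_uniform x" for x
    unfolding std_uniform_def by (rule sum_nonneg) simp
  have mono: "mono std_uniform"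
  proof (rule monoI)
    fix x y :: "bool list"
    assume "x \<le> y"
    then have "{..x} - {[]} \<subseteq> {..y} - {[]}"
      by (metis Diff_mono atMost_subset_iff order_refl)
    then show "std_uniform x \<le> std_uniform y"
      unfolding std_uniform_def
      by (intro sum_mono2) (simp_all add: finite_atMost_string)
  qed
  have "(std_uniform \<longlongrightarrow> 1) at_top"
  proof (rule order_tendstoI)
    fix a :: real
    assume "1 < a"
    then show "\<forall>\<^sub>F x in at_top. std_uniform x < a"
      by (intro always_eventually allI le_less_trans[OF up])
  next
    fix a :: real
    assume "a < 1"
    then obtain n where n: "inverse (real (Suc n)) < 1 - a"
      using reals_Archimedean[of "1 - a"] by auto
    define z where "z = replicate (Suc n) False"
    have "a < 1 - 1 / (real n + 1)"
      using n by (simp add: inverse_eq_divide add.commute)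
    also have "\<dots> = (\<Sum>y | length y \<le> n \<and> y \<noteq> []. ?w y)"
      by (simp only: sum_std_uniform_length_le)
    also have "\<dots> \<le> std_uniform z"
      unfolding std_uniform_def
      by (rule sum_mono2)
         (auto simp: finite_atMost_string z_def list_le_def list_less_def lenlex_conv)
    finally have "a < std_uniform z" .
    then have "a < std_uniform x" if "z \<le> x" for x
      using monoD[OF mono that] by simp
    then show "\<forall>\<^sub>F x in at_top. a < std_uniform x"
      by (rule eventually_mono[OF eventually_ge_at_top[of z]])
  qed
  then show ?thesis
    using up low mono by (simp add: distribution_def image_subset_iff)
qed


section \<open>Self-knowing correctness\<close>

datatype confidence = Definitely | Maybe

definition self_knowingly_correct :: "('s \<Rightarrow> 't \<times> confidence) \<Rightarrow> ('s \<Rightarrow> 't) \<Rightarrow> bool" where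
  "self_knowingly_correct A f \<longleftrightarrow> (\<forall>s t. A s = (t, Definitely) \<longrightarrow> f s = t)"

definition frequently_self_knowingly_correct ::
    "(bool list \<Rightarrow> 't \<times> confidence) \<Rightarrow> (bool list \<Rightarrow> 't) \<Rightarrow> bool" where
  "frequently_self_knowingly_correct A g \<longleftrightarrow>
     self_knowingly_correct A g \<and>
     (\<lambda>n. real (card {x. length x = n \<and> A x \<in> UNIV \<times> {Maybe}}) /
          real (card {x :: bool list. length x = n})) \<longlonglongrightarrow> 0"

text \<open>
  For a machine to output a pair, the pair is written as a string: a bit for the confidence,
  followed by the first component.
\<close>

fun encode_answer :: "bool list \<times> confidence \<Rightarrow> bool list" where
  "encode_answer (y, c) = (c = Definitely) # y"

definition poly_time_algorithm :: "(bool list \<Rightarrow> bool list \<times> confidence) \<Rightarrow> bool" where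
  "poly_time_algorithm A \<longleftrightarrow> (\<exists>M. computes M (encode_answer \<circ> A) \<and> poly_time M)"

end

theory Submission
  imports Defs
begin

text \<open>
  Run a machine for \<open>f\<close> with a clock that stops it after \<open>(n + 1)\<^sup>k - 1\<close> steps on inputs of length
  \<open>n\<close>, and answer ``maybe'' when the clock runs out. The clock is a \<open>k\<close>-digit counter in base \<open>n + 1\<close>
  on \<open>k\<close> extra tapes, decremented within the simulated step itself. If the running time is polynomial
  on the average, then for large \<open>k\<close> Markov's inequality shows that the clock runs out on a vanishing
  proportion of the inputs of each length.
\<close>

section \<open>Runs of machines\<close>

lemma halted_step: "halted M c \<Longrightarrow> step M c = c"
  by (simp add: halted_def step_def)

lemma halted_steps: "halted M c \<Longrightarrow> (step M ^^ n) c = c"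
  by (induction n) (simp_all add: halted_step)

lemma run_Suc: "run M x (Suc n) = step M (run M x n)"
  by (simp add: run_def)

lemma run_add: "run M x (m + n) = (step M ^^ n) (run M x m)"
  by (simp add: run_def funpow_add add.commute[of m])

lemma halted_run_mono: "halted M (run M x m) \<Longrightarrow> m \<le> n \<Longrightarrow> run M x n = run M x m"
  by (metis halted_steps le_add_diff_inverse run_add)

lemma time_le: "halted M (run M x n) \<Longrightarrow> time M x \<le> n"
  by (simp add: time_def Least_le)

lemma halted_time: "halted M (run M x n) \<Longrightarrow> halted M (run M x (time M x))"
  unfolding time_def by (rule LeastI)

text \<open>Halted configurations are fixed points, so any halting time shows the final
  configuration; the exact value of \<open>time\<close> for the clocked machine is never
  computed.\<close>

lemma run_time: "halted M (run M x n) \<Longrightarrow> run M x (time M x) = run M x n"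
  by (metis halted_run_mono halted_time time_le)

lemma not_halted_before_time: "n < time M x \<Longrightarrow> \<not> halted M (run M x n)"
  unfolding time_def by (rule not_less_Least)

text \<open>Invariant of runs: only symbols of \<open>M\<close> are ever scanned, so the symbol
  guard in \<open>clocked_delta\<close> succeeds throughout the simulation.\<close>

definition wf_config :: "machine \<Rightarrow> config \<Rightarrow> bool" where
  "wf_config M c \<longleftrightarrow> fst c < states M \<and> length (snd c) = tapes M \<and>
     (\<forall>tp \<in> set (snd c). \<forall>i. snd tp i < symbs M)"

lemma set_map_scan: "wf_config M c \<Longrightarrow> set (map scan (snd c)) \<subseteq> {..<symbs M}"
  by (auto simp: wf_config_def scan_def)

lemma wf_config_step:
  assumes "wf_machine M" "wf_config M c"
  shows "wf_config M (step M c)"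
proof (cases "fst c = final M")
  case False
  obtain q as where d: "delta M (fst c) (map scan (snd c)) = (q, as)"
    by fastforce
  have "q < states M" "length as = tapes M" and as: "\<forall>a \<in> set as. fst a < symbs M"
    using assms False set_map_scan[OF assms(2)] d
    unfolding wf_machine_def wf_config_def by (metis fst_conv snd_conv length_map)+
  moreover have "snd (act a tp) i < symbs M" if "(a, tp) \<in> set (zip as (snd c))" for a tp i
    using set_zip_leftD[OF that] set_zip_rightD[OF that] as assms(2)
    by (auto simp: act_def wf_config_def)
  ultimately show ?thesis
    using False d assms(2) by (auto simp: step_def wf_config_def)
qed (use assms in \<open>simp add: step_def\<close>)

lemma wf_config_init: "wf_machine M \<Longrightarrow> wf_config M (init M x)"
  by (auto simp: wf_config_def wf_machine_def init_def input_tape_def bit_symb_def)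

lemma wf_config_run: "wf_machine M \<Longrightarrow> wf_config M (run M x n)"
  by (induction n) (simp_all add: run_Suc wf_config_step run_def[of _ _ 0] wf_config_init)

lemma has_output_iff:
  "has_output (q, (h, w) # ts) y \<longleftrightarrow>
     (\<forall>i < length y. w (h + int i) = bit_symb (y ! i)) \<and> w (h + int (length y)) = 0"
  by (simp add: has_output_def)

text \<open>Output is read rightwards from the head, so the confidence bit can be prepended without
  shifting the word, whatever stood in the cell to its left.\<close>

lemma has_output_Cons:
  assumes "has_output (q, (h, w) # ts) y"
  shows "has_output (q', (h - 1, w(h - 1 := bit_symb b)) # ts') (b # y)"
proof -
  have "(w(h - 1 := bit_symb b)) (h - 1 + int i) = bit_symb ((b # y) ! i)" if "i < length (b # y)" for i
    using assms that by (cases i) (auto simp: has_output_iff)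
  then show ?thesis
    using assms by (simp add: has_output_iff)
qed


section \<open>Clock tapes\<close>

text \<open>
  A digit of the clock is a rotor walk on the cells \<open>0, \<dots>, N\<close>. The cells \<open>0\<close> and \<open>N\<close> carry the
  symbols 0 and 1; an inner cell carries 2 or 3, which sends the head to the left or to the right
  and is then replaced by the other one. So the head sweeps to and fro, and the digit is the number
  of moves that remain until an end is reached.
\<close>

definition rotor :: "nat \<Rightarrow> tape \<Rightarrow> nat \<Rightarrow> bool" where
  "rotor N tp r \<longleftrightarrow> (case tp of (p, w) \<Rightarrow>
     w 0 = 0 \<and> w (int N) = 1 \<and> (\<forall>i. 0 < i \<and> i < p \<longrightarrow> w i = 2) \<and>
     (\<forall>i. p < i \<and> i < int N \<longrightarrow> w i = 3) \<and>
     ((p = 0 \<or> p = int N) \<and> r = 0 \<or>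
      0 < p \<and> p < int N \<and> (w p = 2 \<and> int r = p \<or> w p = 3 \<and> int r = int N - p)))"

text \<open>Scanning 2 excludes both ends, so the head is on an inner cell. The 3 left behind
  extends the block of 3s to the right of the new head position.\<close>

lemma rotor_left:
  assumes "rotor N tp r" "scan tp = 2"
  shows "r > 0 \<and> rotor N (act (3, MoveLeft) tp) (r - 1)"
  using assms by (cases tp) (auto simp: rotor_def scan_def act_def)

lemma rotor_right:
  assumes "rotor N tp r" "scan tp = 3"
  shows "r > 0 \<and> rotor N (act (2, MoveRight) tp) (r - 1)"
  using assms by (cases tp) (auto simp: rotor_def scan_def act_def)

text \<open>Any other symbol means that the head is at an end, where the digit is 0. Turning back
  starts a full sweep, which is the borrow from 0 to \<open>N - 1\<close>; for \<open>N = 1\<close>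
  the head lands on the opposite end.\<close>

lemma rotor_bounce:
  assumes "rotor N tp r" "scan tp \<noteq> 2" "scan tp \<noteq> 3" "N > 0"
  shows "r = 0 \<and> rotor N (act (scan tp, if scan tp = 0 then MoveRight else MoveLeft) tp) (N - 1)"
  using assms by (cases tp) (auto simp: rotor_def scan_def act_def)

fun clock :: "nat \<Rightarrow> tape list \<Rightarrow> nat \<Rightarrow> bool" where
  "clock N [] v \<longleftrightarrow> v = 0"
| "clock N (tp # tps) v \<longleftrightarrow> (\<exists>r v'. rotor N tp r \<and> clock N tps v' \<and> v = r + N * v')"

lemma clockI: "rotor N tp r \<Longrightarrow> clock N tps v \<Longrightarrow> u = r + N * v \<Longrightarrow> clock N (tp # tps) u"
  by auto

definition keep :: "nat list \<Rightarrow> (nat \<times> move) list" where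
  "keep = map (\<lambda>s. (s, Stay))"

text \<open>Decrement with borrow, least significant digit first. A zero digit is recognised by its
  scanned symbol alone, so the borrow passes through all digits in one step; \<open>None\<close>
  signals that every digit is zero.\<close>

fun tick :: "nat list \<Rightarrow> (nat \<times> move) list option" where
  "tick [] = None"
| "tick (s # ss) =
     (if s = 2 then Some ((3, MoveLeft) # keep ss)
      else if s = 3 then Some ((2, MoveRight) # keep ss)
      else map_option ((#) (s, if s = 0 then MoveRight else MoveLeft)) (tick ss))"

lemma length_keep [simp]: "length (keep ss) = length ss"
  by (simp add: keep_def)

lemma act_scan_Stay [simp]: "act (scan tp, Stay) tp = tp"
  by (cases tp) (simp add: act_def scan_def)

lemma act_keep [simp]: "map2 act (keep (map scan tps)) tps = tps"
  by (induction tps) (simp_all add: keep_def)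

lemma length_tick: "tick ss = Some as \<Longrightarrow> length as = length ss"
  by (induction ss arbitrary: as) (auto split: if_splits)

lemma tick_symbs:
  "tick ss = Some as \<Longrightarrow> set ss \<subseteq> {..<b} \<Longrightarrow> 4 \<le> b \<Longrightarrow> \<forall>a \<in> set as. fst a < b"
  by (induction ss arbitrary: as) (fastforce simp: keep_def split: if_splits)+

lemma tick_None: "clock N tps v \<Longrightarrow> N > 0 \<Longrightarrow> tick (map scan tps) = None \<Longrightarrow> v = 0"
  by (induction tps arbitrary: v) (auto split: if_splits dest!: rotor_bounce)

lemma tick_Some:
  "clock N tps v \<Longrightarrow> N > 0 \<Longrightarrow> tick (map scan tps) = Some as \<Longrightarrow>
     v > 0 \<and> clock N (map2 act as tps) (v - 1)"
proof (induction tps arbitrary: v as)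
  case (Cons tp tps)
  obtain r v' where r: "rotor N tp r" and v': "clock N tps v'" and v: "v = r + N * v'"
    using Cons.prems(1) by auto
  consider "scan tp = 2" | "scan tp = 3" | "scan tp \<noteq> 2" "scan tp \<noteq> 3"
    by blast
  then show ?case
  proof cases
    case 1
    then have "as = (3, MoveLeft) # keep (map scan tps)"
      using Cons.prems(3) by simp
    with rotor_left[OF r 1] v v' show ?thesis
      by (auto intro!: clockI simp del: clock.simps)
  next
    case 2
    then have "as = (2, MoveRight) # keep (map scan tps)"
      using Cons.prems(3) by simp
    with rotor_right[OF r 2] v v' show ?thesis
      by (auto intro!: clockI simp del: clock.simps)
  next
    case 3
    then obtain bs where bs: "tick (map scan tps) = Some bs"
      and as: "as = (scan tp, if scan tp = 0 then MoveRight else MoveLeft) # bs"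
      using Cons.prems(3) by auto
    have IH: "v' > 0" "clock N (map2 act bs tps) (v' - 1)"
      using Cons.IH[OF v' Cons.prems(2) bs] by auto
    have R: "r = 0" "rotor N (act (hd as) tp) (N - 1)"
      using rotor_bounce[OF r 3 Cons.prems(2)] as by auto
    \<comment> \<open>The borrow: here \<open>v = N * v'\<close> with \<open>v' > 0\<close>.\<close>
    have "v - 1 = N - 1 + N * (v' - 1)" "v > 0"
      using R(1) v IH(1) Cons.prems(2) by (cases v'; simp)+
    then show ?thesis
      using IH(2) R(2) as by auto
  qed
qed simp

text \<open>This is the largest numeral with \<open>k\<close> digits. Its digits are all equal, so
  all clock tapes can be wound up simultaneously and identically.\<close>

lemma clock_replicate: "rotor N tp (N - 1) \<Longrightarrow> N > 0 \<Longrightarrow> clock N (replicate k tp) (N ^ k - 1)"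
proof (induction k)
  case (Suc k)
  have "N ^ Suc k - 1 = N - 1 + N * (N ^ k - 1)"
    using Suc.prems(2) by (cases "N ^ k") (simp_all add: algebra_simps)
  with Suc show ?case
    by (simp add: clockI del: clock.simps power_Suc)
qed simp


section \<open>The clocked machine\<close>

text \<open>
  The states of \<open>M\<close> are followed by seven new ones, numbered from \<open>S = states M\<close>. In \<open>S\<close>, \<open>S + 1\<close>
  and \<open>S + 2\<close> the clock tapes are wound up along the input and the first head returns to its start;
  \<open>S + 3\<close> puts the bit for ``definitely'' in front of the output of \<open>M\<close>; \<open>S + 4\<close> and \<open>S + 5\<close>
  produce the answer ``maybe'' with the empty word; \<open>S + 6\<close> is final.
\<close>

definition clocked_delta :: "machine \<Rightarrow> nat \<Rightarrow> nat list \<Rightarrow> nat \<times> (nat \<times> move) list" where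
  "clocked_delta M q ss =
     (let S = states M; s = hd ss; us = take (tapes M - 1) (tl ss); cs = drop (tapes M - 1) (tl ss);
          go = (\<lambda>q' a as. (q', a # keep us @ as))
      in if q < S then
           if q = final M then go (S + 3) (s, MoveLeft) (keep cs)
           else (case tick cs of
               None \<Rightarrow> go (S + 4) (s, MoveRight) (keep cs)
             | Some as \<Rightarrow>
                 if set (s # us) \<subseteq> {..<symbs M} then
                   (fst (delta M q (s # us)), snd (delta M q (s # us)) @ as)
                 else go q (s, Stay) (keep cs))
         else if q = S then go (S + 1) (s, Stay) (map (\<lambda>_. (0, MoveRight)) cs)
         else if q = S + 1 then
           if s = 0 then go (S + 2) (s, MoveLeft) (map (\<lambda>_. (1, MoveLeft)) cs)
           else go (S + 1) (s, MoveRight) (map (\<lambda>_. (2, MoveRight)) cs)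
         else if q = S + 2 then
           if s = 0 then go (start M) (s, MoveRight) (keep cs)
           else go (S + 2) (s, MoveLeft) (keep cs)
         else if q = S + 3 then go (S + 6) (2, Stay) (keep cs)
         else if q = S + 4 then go (S + 5) (0, MoveLeft) (keep cs)
         else go (S + 6) (1, Stay) (keep cs))"

text \<open>The clock uses the symbols 0 to 3, whereas \<open>M\<close> may have only three symbols;
  hence the extra symbol.\<close>

definition clocked :: "nat \<Rightarrow> machine \<Rightarrow> machine" where
  "clocked k M =
     \<lparr>tapes = tapes M + k, symbs = symbs M + 1, states = states M + 7,
      start = states M, final = states M + 6, delta = clocked_delta M\<rparr>"

lemma clocked_simps [simp]:
  "tapes (clocked k M) = tapes M + k" "symbs (clocked k M) = symbs M + 1"
  "states (clocked k M) = states M + 7" "start (clocked k M) = states M"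
  "final (clocked k M) = states M + 6" "delta (clocked k M) = clocked_delta M"
  by (simp_all add: clocked_def)

text \<open>Well-formedness also concerns combinations that never occur in a run. On the extra
  symbol \<open>delta M\<close> is unconstrained; there \<open>clocked_delta\<close> stays in its
  state instead of consulting it.\<close>

lemma wf_clocked:
  assumes M: "wf_machine M"
  shows "wf_machine (clocked k M)"
proof -
  have "fst (clocked_delta M q ss) < states M + 7 \<and>
      length (snd (clocked_delta M q ss)) = tapes M + k \<and>
      (\<forall>a \<in> set (snd (clocked_delta M q ss)). fst a < symbs M + 1)"
    if len: "length ss = tapes M + k" and sub: "set ss \<subseteq> {..<symbs M + 1}" for q ss
  proof -
    define s us cs where "s = hd ss" and "us = take (tapes M - 1) (tl ss)"
      and "cs = drop (tapes M - 1) (tl ss)"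
    have m: "tapes M \<ge> 1" "symbs M \<ge> 3" "start M < states M"
      using M by (auto simp: wf_machine_def)
    then have ss: "ss = s # us @ cs"
      using len by (cases ss) (auto simp: s_def us_def cs_def)
    have lens: "length us = tapes M - 1" "length cs = k"
      using len m by (auto simp: us_def cs_def)
    have sy: "s < symbs M + 1" "set us \<subseteq> {..<symbs M + 1}" "set cs \<subseteq> {..<symbs M + 1}"
      using sub ss by auto
    have keep: "\<forall>a \<in> set (keep us). fst a < symbs M + 1" "\<forall>a \<in> set (keep cs). fst a < symbs M + 1"
      using sy by (auto simp: keep_def)
    have tick: "length as = k \<and> (\<forall>a \<in> set as. fst a < symbs M + 1)" if "tick cs = Some as" for as
      using length_tick[OF that] tick_symbs[OF that sy(3)] m lens by auto
    have len': "length (s # us) = tapes M"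
      using lens m by simp
    define ok where "ok p \<longleftrightarrow> fst p < states M + 7 \<and> length (snd p) = tapes M + k \<and>
        (\<forall>a \<in> set (snd p). fst a < symbs M + 1)" for p :: "nat \<times> (nat \<times> move) list"
    have sim: "ok (fst (delta M q (s # us)), snd (delta M q (s # us)) @ as)"
      if "tick cs = Some as" "q < states M" "q \<noteq> final M" "set (s # us) \<subseteq> {..<symbs M}" for as
    proof -
      have "fst (delta M q (s # us)) < states M \<and> length (snd (delta M q (s # us))) = tapes M \<and>
          (\<forall>a \<in> set (snd (delta M q (s # us))). fst a < symbs M)"
        using M that(2-4) len' unfolding wf_machine_def by blast
      with tick[OF that(1)] show ?thesis
        by (auto simp: ok_def)
    qed
    have go: "ok (q', a # keep us @ as)"
      if "q' < states M + 7" "fst a < symbs M + 1" "length as = k" "\<forall>a \<in> set as. fst a < symbs M + 1"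
      for q' a as
      using that keep(1) len' by (auto simp: ok_def)
    have ok_if: "(b \<Longrightarrow> ok u) \<Longrightarrow> (\<not> b \<Longrightarrow> ok v) \<Longrightarrow> ok (if b then u else v)" for b u v
      by simp
    have ok_option: "(z = None \<Longrightarrow> ok u) \<Longrightarrow> (\<And>as. z = Some as \<Longrightarrow> ok (v as)) \<Longrightarrow>
        ok (case z of None \<Rightarrow> u | Some as \<Rightarrow> v as)" for z :: "(nat \<times> move) list option" and u v
      by (simp split: option.split)
    have "ok (clocked_delta M q ss)"
      unfolding clocked_delta_def Let_def s_def[symmetric] us_def[symmetric] cs_def[symmetric]
      by (intro ok_if ok_option go sim) (use keep(2) lens(2) m sy(1) in simp_all)
    then show ?thesis
      by (simp add: ok_def)
  qed
  then show ?thesis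
    using M by (auto simp: wf_machine_def)
qed

section \<open>Single steps of the clocked machine\<close>

lemma act_scan: "scan t = s \<Longrightarrow> act (s, d) t = (fst t + offset d, snd t)"
  by (auto simp: act_def scan_def)

text \<open>Common form of all transitions other than simulated steps of \<open>M\<close>: the tapes
  \<open>ts\<close> are left alone.\<close>

lemma step_clocked:
  assumes "length ts = tapes M - 1" "q \<noteq> states M + 6" "length as = length cs"
    and "clocked_delta M q (scan t # map scan ts @ map scan cs) = (q', a # keep (map scan ts) @ as)"
  shows "step (clocked k M) (q, t # ts @ cs) = (q', act a t # ts @ map2 act as cs)"
  using assms by (simp add: step_def)

context
  fixes M :: machine and ts :: "tape list"
  assumes ts: "length ts = tapes M - 1"
begin

lemma step_clocked_start:
  "step (clocked k M) (states M, t # ts @ replicate n c) =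
     (states M + 1, t # ts @ replicate n (act (0, MoveRight) c))"
  by (subst step_clocked[OF ts, where as = "replicate n (0, MoveRight)" and a = "(scan t, Stay)"])
     (simp_all add: ts clocked_delta_def zip_replicate)

lemma step_clocked_wind:
  "scan t \<noteq> 0 \<Longrightarrow> step (clocked k M) (states M + 1, t # ts @ replicate n c) =
     (states M + 1, (fst t + 1, snd t) # ts @ replicate n (act (2, MoveRight) c))"
  by (subst step_clocked[OF ts, where as = "replicate n (2, MoveRight)" and a = "(scan t, MoveRight)"])
     (simp_all add: ts clocked_delta_def zip_replicate act_scan)

lemma step_clocked_wound:
  "scan t = 0 \<Longrightarrow> step (clocked k M) (states M + 1, t # ts @ replicate n c) =
     (states M + 2, (fst t - 1, snd t) # ts @ replicate n (act (1, MoveLeft) c))"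
  by (subst step_clocked[OF ts, where as = "replicate n (1, MoveLeft)" and a = "(scan t, MoveLeft)"])
     (simp_all add: ts clocked_delta_def zip_replicate act_scan)

lemma step_clocked_rewind:
  "scan t \<noteq> 0 \<Longrightarrow> step (clocked k M) (states M + 2, t # ts @ cs) =
     (states M + 2, (fst t - 1, snd t) # ts @ cs)"
  by (subst step_clocked[OF ts, where as = "keep (map scan cs)" and a = "(scan t, MoveLeft)"])
     (simp_all add: ts clocked_delta_def act_scan)

lemma step_clocked_rewound:
  "scan t = 0 \<Longrightarrow> step (clocked k M) (states M + 2, t # ts @ cs) =
     (start M, (fst t + 1, snd t) # ts @ cs)"
  by (subst step_clocked[OF ts, where as = "keep (map scan cs)" and a = "(scan t, MoveRight)"])
     (simp_all add: ts clocked_delta_def act_scan)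

lemma step_clocked_final:
  "final M < states M \<Longrightarrow> step (clocked k M) (final M, t # ts @ cs) =
     (states M + 3, (fst t - 1, snd t) # ts @ cs)"
  by (subst step_clocked[OF ts, where as = "keep (map scan cs)" and a = "(scan t, MoveLeft)"])
     (simp_all add: ts clocked_delta_def act_scan)

lemma step_clocked_definitely:
  "step (clocked k M) (states M + 3, (h, w) # ts @ cs) = (states M + 6, (h, w(h := 2)) # ts @ cs)"
  by (subst step_clocked[OF ts, where as = "keep (map scan cs)" and a = "(2, Stay)"])
     (simp_all add: ts clocked_delta_def, simp add: act_def)

lemma step_clocked_timeout:
  "q < states M \<Longrightarrow> q \<noteq> final M \<Longrightarrow> tick (map scan cs) = None \<Longrightarrow>
     step (clocked k M) (q, t # ts @ cs) = (states M + 4, (fst t + 1, snd t) # ts @ cs)"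
  by (subst step_clocked[OF ts, where as = "keep (map scan cs)" and a = "(scan t, MoveRight)"])
     (simp_all add: ts clocked_delta_def act_scan)

lemma step_clocked_clear:
  "step (clocked k M) (states M + 4, (h, w) # ts @ cs) =
     (states M + 5, (h - 1, w(h := 0)) # ts @ cs)"
  by (subst step_clocked[OF ts, where as = "keep (map scan cs)" and a = "(0, MoveLeft)"])
     (simp_all add: ts clocked_delta_def, simp add: act_def)

lemma step_clocked_maybe:
  "step (clocked k M) (states M + 5, (h, w) # ts @ cs) = (states M + 6, (h, w(h := 1)) # ts @ cs)"
  by (subst step_clocked[OF ts, where as = "keep (map scan cs)" and a = "(1, Stay)"])
     (simp_all add: ts clocked_delta_def, simp add: act_def)

end

lemma wf_config_tapes:
  assumes "wf_machine M" "wf_config M c"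
  obtains t ts where "snd c = t # ts" "length ts = tapes M - 1"
  using assms by (cases "snd c") (auto simp: wf_config_def wf_machine_def)

lemma step_clocked_simulate:
  assumes M: "wf_machine M" and c: "wf_config M c" "\<not> halted M c"
    and as: "tick (map scan cs) = Some as"
  shows "step (clocked k M) (fst c, snd c @ cs) = (fst (step M c), snd (step M c) @ map2 act as cs)"
proof -
  obtain t ts where tts: "snd c = t # ts" "length ts = tapes M - 1"
    using wf_config_tapes[OF M c(1)] .
  obtain q bs where d: "delta M (fst c) (scan t # map scan ts) = (q, bs)"
    by fastforce
  have q: "fst c < states M" "fst c \<noteq> final M" and len: "length (t # ts) = tapes M"
    using c tts by (auto simp: wf_config_def halted_def)
  have sub: "set (scan t # map scan ts) \<subseteq> {..<symbs M}"
    using set_map_scan[OF c(1)] tts by simp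
  \<comment> \<open>This length makes \<open>zip\<close> split exactly between the tapes of
    \<open>M\<close> and the clock tapes.\<close>
  have "length bs = tapes M"
    using M q sub d len unfolding wf_machine_def by (metis length_Cons length_map snd_conv)
  moreover have "clocked_delta M (fst c) (scan t # map scan ts @ map scan cs) = (q, bs @ as)"
    using q sub d as tts by (simp add: clocked_delta_def)
  ultimately show ?thesis
    using q d len by (simp add: step_def tts(1) zip_append1 flip: append_Cons)
qed

section \<open>Winding up the clock tapes\<close>

definition wound :: "nat \<Rightarrow> tape" where
  "wound j = (int j + 1, \<lambda>i. if 1 \<le> i \<and> i \<le> int j then 2 else 0)"

lemma wound_Suc: "act (2, MoveRight) (wound j) = wound (Suc j)"
  by (auto simp: wound_def act_def)

text \<open>The 1 completes the track of base \<open>n + 1\<close>. The head rests on cell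
  \<open>n\<close> with only 2s down to cell 0, so the digit is maximal; for \<open>n = 0\<close> it
  is already at the left end.\<close>

lemma rotor_wound: "rotor (n + 1) (act (1, MoveLeft) (wound n)) n"
  by (auto simp: wound_def act_def rotor_def)

lemma scan_input_tape:
  "scan (i, snd (input_tape x)) = 0 \<longleftrightarrow> \<not> (0 \<le> i \<and> i < int (length x))"
  by (simp add: scan_def input_tape_def bit_symb_def)

text \<open>The first step only moves the clock heads off cell 0; each later one passes an input
  symbol and writes a 2 on every clock tape.\<close>

lemma run_clocked_wind:
  assumes "wf_machine M" "j \<le> length x"
  shows "run (clocked k M) x (Suc j) =
    (states M + 1, (int j, snd (input_tape x)) # replicate (tapes M - 1) (0, \<lambda>_. 0) @
       replicate k (wound j))"
  using assms(2)
proof (induction j)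
  case 0
  have "tapes M + k - 1 = (tapes M - 1) + k"
    using assms(1) by (simp add: wf_machine_def)
  then have "init (clocked k M) x = (states M, input_tape x #
      replicate (tapes M - 1) (0, \<lambda>_. 0) @ replicate k (0, \<lambda>_. 0))"
    by (simp add: init_def replicate_add)
  moreover have "act (0, MoveRight) (0, \<lambda>_. 0) = wound 0"
    by (auto simp: act_def wound_def)
  moreover have "input_tape x = (int 0, snd (input_tape x))"
    by (simp add: input_tape_def)
  ultimately show ?case
    by (simp add: run_def step_clocked_start)
next
  case (Suc j)
  have "step (clocked k M) (states M + 1, (int j, snd (input_tape x)) #
      replicate (tapes M - 1) (0, \<lambda>_. 0) @ replicate k (wound j)) =
    (states M + 1, (int (Suc j), snd (input_tape x)) #
      replicate (tapes M - 1) (0, \<lambda>_. 0) @ replicate k (wound (Suc j)))"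
    using Suc.prems by (subst step_clocked_wind) (simp_all add: scan_input_tape wound_Suc del: neq0_conv)
  then show ?case
    using Suc by (simp only: run_Suc[of _ _ "Suc j"] Suc_leD)
qed

text \<open>Setting the right end marks costs one step after the \<open>length x + 1\<close> winding
  steps. At \<open>j = length x\<close> the first head is on the blank cell \<open>-1\<close>, which
  stops the rewinding.\<close>

lemma run_clocked_rewind:
  assumes "wf_machine M" "j \<le> length x"
  shows "run (clocked k M) x (length x + 2 + j) =
    (states M + 2, (int (length x) - 1 - int j, snd (input_tape x)) #
       replicate (tapes M - 1) (0, \<lambda>_. 0) @ replicate k (act (1, MoveLeft) (wound (length x))))"
  using assms(2)
proof (induction j)
  case 0
  have "run (clocked k M) x (length x + 2) = step (clocked k M) (run (clocked k M) x (Suc (length x)))"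
    by (simp add: run_Suc)
  then show ?case
    using run_clocked_wind[OF assms(1) order_refl]
    by (simp add: step_clocked_wound[simplified] scan_input_tape)
next
  case (Suc j)
  have "step (clocked k M) (states M + 2, (int (length x) - 1 - int j, snd (input_tape x)) #
      replicate (tapes M - 1) (0, \<lambda>_. 0) @ replicate k (act (1, MoveLeft) (wound (length x)))) =
    (states M + 2, (int (length x) - 1 - int (Suc j), snd (input_tape x)) #
      replicate (tapes M - 1) (0, \<lambda>_. 0) @ replicate k (act (1, MoveLeft) (wound (length x))))"
    using Suc.prems by (subst step_clocked_rewind) (simp_all add: scan_input_tape del: neq0_conv)
  then show ?case
    using Suc by (simp only: run_Suc add_Suc_right Suc_leD)
qed

lemma run_clocked_start:
  assumes "wf_machine M"
  shows "run (clocked k M) x (2 * length x + 3) =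
    (start M, snd (init M x) @ replicate k (act (1, MoveLeft) (wound (length x))))"
proof -
  have "run (clocked k M) x (2 * length x + 3) =
      step (clocked k M) (run (clocked k M) x (length x + 2 + length x))"
    by (simp add: run_Suc[symmetric] numeral_eq_Suc)
  moreover have "input_tape x = (0, snd (input_tape x))"
    by (simp add: input_tape_def)
  ultimately show ?thesis
    using run_clocked_rewind[OF assms order_refl, of k x]
    by (simp add: step_clocked_rewound[simplified] scan_input_tape init_def)
qed

section \<open>Simulation, answer and running time\<close>

definition bound :: "nat \<Rightarrow> bool list \<Rightarrow> nat" where
  "bound k x = (length x + 1) ^ k - 1"

text \<open>Lockstep: before each step counted here the clock is positive and \<open>M\<close> has
  not halted, so one step of the clocked machine is one step of \<open>M\<close> and one
  tick.\<close>

lemma run_clocked_simulate: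
  assumes M: "wf_machine M" and "i \<le> bound k x" "i \<le> time M x"
  shows "\<exists>cs. clock (length x + 1) cs (bound k x - i) \<and>
    run (clocked k M) x (2 * length x + 3 + i) = (fst (run M x i), snd (run M x i) @ cs)"
  using assms(2-3)
proof (induction i)
  case 0
  have "clock (length x + 1) (replicate k (act (1, MoveLeft) (wound (length x)))) (bound k x)"
    using clock_replicate[of "length x + 1"] rotor_wound[of "length x"] by (simp add: bound_def)
  then show ?case
    using run_clocked_start[OF M] by (auto simp: run_def init_def)
next
  case (Suc i)
  then obtain cs where cs: "clock (length x + 1) cs (bound k x - i)"
    and r: "run (clocked k M) x (2 * length x + 3 + i) = (fst (run M x i), snd (run M x i) @ cs)"
    by auto
  have nh: "\<not> halted M (run M x i)"
    using Suc.prems not_halted_before_time by simp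
  obtain as where as: "tick (map scan cs) = Some as"
    using tick_None[OF cs] Suc.prems by (cases "tick (map scan cs)") auto
  have "clock (length x + 1) (map2 act as cs) (bound k x - Suc i)"
    using tick_Some[OF cs _ as] by simp
  moreover have "run (clocked k M) x (2 * length x + 3 + Suc i) =
      (fst (run M x (Suc i)), snd (run M x (Suc i)) @ map2 act as cs)"
    using step_clocked_simulate[OF M wf_config_run[OF M] nh as] r
    by (simp only: run_Suc add_Suc_right)
  ultimately show ?case
    by blast
qed

definition clocked_answer ::
    "nat \<Rightarrow> machine \<Rightarrow> (bool list \<Rightarrow> bool list) \<Rightarrow> bool list \<Rightarrow> bool list \<times> confidence" where
  "clocked_answer k M f x = (if time M x \<le> bound k x then (f x, Definitely) else ([], Maybe))"

lemma clocked_halts: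
  assumes "computes M f"
  shows "\<exists>j \<le> 2 * length x + bound k x + 6. halted (clocked k M) (run (clocked k M) x j) \<and>
    has_output (run (clocked k M) x j) (encode_answer (clocked_answer k M f x))"
proof -
  have M: "wf_machine M" and fin: "final M < states M" "halted M (run M x (time M x))"
    and out: "has_output (run M x (time M x)) (f x)"
    using assms by (auto simp: computes_def wf_machine_def intro: halted_time)
  define i where "i = min (time M x) (bound k x)"
  obtain cs where cs: "clock (length x + 1) cs (bound k x - i)"
    and r: "run (clocked k M) x (2 * length x + 3 + i) = (fst (run M x i), snd (run M x i) @ cs)"
    using run_clocked_simulate[OF M, of i k x] by (auto simp: i_def)
  obtain t ts where tts: "snd (run M x i) = t # ts" and ts: "length ts = tapes M - 1"
    using wf_config_tapes[OF M wf_config_run[OF M]] .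
  obtain h w where t: "t = (h, w)"
    by fastforce
  show ?thesis
  \<comment> \<open>Equality belongs to the first case because \<open>clocked_delta\<close> tests
    for the final state of \<open>M\<close> before it looks at the clock.\<close>
  proof (cases "time M x \<le> bound k x")
    case True
    then have i: "i = time M x"
      by (simp add: i_def)
    have "run (clocked k M) x (2 * length x + 3 + i + 2) =
        (states M + 6, (h - 1, w(h - 1 := bit_symb True)) # ts @ cs)"
      using r tts t fin i step_clocked_final[OF ts] step_clocked_definitely[OF ts]
      by (simp add: numeral_eq_Suc run_Suc halted_def bit_symb_def)
    moreover have "has_output (fst (run M x i), (h, w) # ts) (f x)"
      using out i tts t by (metis prod.collapse)
    ultimately show ?thesis
      using True i
      by (intro exI[of _ "2 * length x + 3 + i + 2"])
         (simp add: halted_def clocked_answer_def has_output_Cons)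
  next
    case False
    then have i: "i = bound k x" "i < time M x"
      by (simp_all add: i_def)
    have "fst (run M x i) < states M" "fst (run M x i) \<noteq> final M"
      using wf_config_run[OF M] not_halted_before_time[OF i(2)]
      by (auto simp: wf_config_def halted_def)
    moreover have "tick (map scan cs) = None"
      using tick_Some[OF cs] i by (cases "tick (map scan cs)") auto
    \<comment> \<open>The blank in cell \<open>h + 1\<close> cuts off whatever \<open>M\<close> has
      left there, and the 1 in cell \<open>h\<close> is the bit for \<open>Maybe\<close>, so the
      output is \<open>[False]\<close>.\<close>
    ultimately have "run (clocked k M) x (2 * length x + 3 + i + 3) =
        (states M + 6, (h, w(h + 1 := 0, h := 1)) # ts @ cs)"
      using r tts t step_clocked_timeout[OF ts] step_clocked_clear[OF ts] step_clocked_maybe[OF ts]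
      by (simp add: numeral_eq_Suc run_Suc)
    then show ?thesis
      using False i
      by (intro exI[of _ "2 * length x + 3 + i + 3"])
         (simp add: halted_def clocked_answer_def has_output_iff bit_symb_def)
  qed
qed

lemma computes_clocked:
  assumes "computes M f"
  shows "computes (clocked k M) (encode_answer \<circ> clocked_answer k M f)"
  using clocked_halts[OF assms] wf_clocked assms run_time unfolding computes_def comp_def by metis

lemma poly_time_clocked:
  assumes "computes M f" "k \<ge> 1"
  shows "poly_time (clocked k M)"
proof -
  have "time (clocked k M) x \<le> (2 ^ k + 7) * length x ^ k + (2 ^ k + 7)" for x
  proof -
    have "time (clocked k M) x \<le> 2 * length x + bound k x + 6"
      using clocked_halts[OF assms(1), of x k] time_le le_trans by blast
    moreover have "length x \<le> length x ^ k"
      using assms(2) by (cases x) (auto intro!: self_le_power)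
    \<comment> \<open>The summand 1 is for the empty string; otherwise
      \<open>length x + 1 \<le> 2 * length x\<close>.\<close>
    moreover have "(length x + 1) ^ k \<le> 2 ^ k * length x ^ k + 1"
    proof (cases "length x = 0")
      case False
      then have "(length x + 1) ^ k \<le> (2 * length x) ^ k"
        by (intro power_mono) (auto simp: Suc_le_eq)
      then show ?thesis
        by (simp add: power_mult_distrib)
    qed simp
    ultimately show ?thesis
      by (simp add: bound_def algebra_simps)
  qed
  then show ?thesis
    unfolding poly_time_def by blast
qed


section \<open>Slow inputs are rare\<close>

lemma finite_strings: "finite {x :: bool list. length x = n}"
  using finite_lists_length_eq[of "UNIV :: bool set" n] by simp

lemma card_strings: "card {x :: bool list. length x = n} = 2 ^ n"
  using card_lists_length_eq[of "UNIV :: bool set" n] by simp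

text \<open>Grouped by length, the sums form a series of nonnegative terms with partial sums at most
  \<open>infsum g A\<close>; it converges, so its terms tend to 0.\<close>

lemma sum_length_tendsto_0:
  fixes g :: "bool list \<Rightarrow> real"
  assumes g: "g summable_on A" and nonneg: "\<And>x. x \<in> A \<Longrightarrow> 0 \<le> g x"
  shows "(\<lambda>n. \<Sum>x | x \<in> A \<and> length x = n. g x) \<longlonglongrightarrow> 0"
proof (rule summable_LIMSEQ_zero[OF summableI_nonneg_bounded])
  fix n
  show "0 \<le> (\<Sum>x | x \<in> A \<and> length x = n. g x)"
    by (rule sum_nonneg) (use nonneg in auto)
  have fin: "finite {x \<in> A. length x = i}" for i
    by (rule finite_subset[OF _ finite_strings[of i]]) auto
  have "(\<Sum>i<n. \<Sum>x | x \<in> A \<and> length x = i. g x) = sum g (\<Union>i<n. {x \<in> A. length x = i})"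
    by (rule sum.UNION_disjoint[symmetric]) (use fin in auto)
  also have "\<dots> \<le> infsum g A"
    by (rule finite_sum_le_infsum[OF g]) (use fin nonneg in auto)
  finally show "(\<Sum>i<n. \<Sum>x | x \<in> A \<and> length x = i. g x) \<le> infsum g A" .
qed

text \<open>
  Markov's inequality on each length: the weights of the strings of length \<open>n\<close> add up to
  about \<open>1 / n\<^sup>2\<close>, so a running time above \<open>n\<^sup>k\<close> contributes at least a constant times the proportion
  of slow inputs as soon as \<open>k * \<epsilon> \<ge> 3\<close>.
\<close>

lemma slow_inputs_rare:
  assumes "poly_on_average t std_uniform"
  obtains k where "k \<ge> 1"
    "(\<lambda>n. real (card {x. length x = n \<and> n ^ k < t x}) / 2 ^ n) \<longlonglongrightarrow> 0"
proof -
  obtain \<epsilon> where \<epsilon>: "\<epsilon> > 0"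
    and sm: "(\<lambda>x. density std_uniform x * (real (t x) powr \<epsilon> / real (length x))) summable_on {x. x \<noteq> []}"
    (is "?g summable_on _")
    using assms by (auto simp: poly_on_average_def)
  define k where "k = nat \<lceil>3 / \<epsilon>\<rceil>"
  have "3 / \<epsilon> \<le> real k"
    unfolding k_def by linarith
  then have k\<epsilon>: "3 \<le> real k * \<epsilon>"
    using \<epsilon> by (simp add: field_simps)
  then have k: "k \<ge> 1"
    by (cases k) auto
  have nonneg: "0 \<le> ?g x" if "x \<noteq> []" for x
    using that by (simp add: density_std_uniform)
  define S where "S n = (\<Sum>x | x \<in> {x. x \<noteq> []} \<and> length x = n. ?g x)" for n
  have S: "(\<lambda>n. 2 * S n) \<longlonglongrightarrow> 0"
    using tendsto_mult_right_zero[OF sum_length_tendsto_0[OF sm nonneg], of 2] by (simp add: S_def)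
  have le: "real (card {x. length x = n \<and> n ^ k < t x}) / 2 ^ n \<le> 2 * S n" if n: "n \<ge> 1" for n
  proof -
    have big: "1 / (2 * 2 ^ n) \<le> ?g x" if x: "length x = n" "n ^ k < t x" for x
    proof -
      have "real n ^ 3 = real n powr 3"
        using n by (simp add: powr_numeral)
      also have "\<dots> \<le> real n powr (real k * \<epsilon>)"
        using k\<epsilon> n by (intro powr_mono) auto
      also have "\<dots> = (real n ^ k) powr \<epsilon>"
        using n by (simp add: powr_powr[symmetric] powr_realpow)
      also have "\<dots> \<le> real (t x) powr \<epsilon>"
        using x(2) \<epsilon> by (intro powr_mono2) (auto simp flip: of_nat_power)
      finally have t: "real n ^ 3 \<le> real (t x) powr \<epsilon>" .
      \<comment> \<open>The right-hand side equals \<open>n / ((n + 1) * 2 ^ n)\<close>, and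
        \<open>n / (n + 1) \<ge> 1 / 2\<close>; this is the source of the factor 2.\<close>
      have "1 / (2 * 2 ^ n) \<le> 1 / (real n * (real n + 1) * 2 ^ n) * (real n ^ 3 / real n)"
        using n by (simp add: divide_simps power3_eq_cube)
      also have "\<dots> \<le> 1 / (real n * (real n + 1) * 2 ^ n) * (real (t x) powr \<epsilon> / real n)"
        using t by (intro mult_left_mono divide_right_mono) auto
      also have "\<dots> = ?g x"
        using x n by (subst density_std_uniform) auto
      finally show ?thesis .
    qed
    have "real (card {x. length x = n \<and> n ^ k < t x}) / (2 * 2 ^ n) =
        (\<Sum>x | length x = n \<and> n ^ k < t x. 1 / (2 * 2 ^ n))"
      by simp
    also have "\<dots> \<le> (\<Sum>x | length x = n \<and> n ^ k < t x. ?g x)"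
      by (rule sum_mono) (use big in blast)
    also have "\<dots> \<le> S n"
      unfolding S_def
    proof (rule sum_mono2)
      show "finite {x :: bool list. x \<in> {x. x \<noteq> []} \<and> length x = n}"
        by (rule finite_subset[OF _ finite_strings[of n]]) auto
    qed (use n nonneg in auto)
    finally show ?thesis
      by simp
  qed
  have "(\<lambda>n. real (card {x. length x = n \<and> n ^ k < t x}) / 2 ^ n) \<longlonglongrightarrow> 0"
    by (rule tendsto_sandwich[OF _ _ tendsto_const S])
       (auto intro: eventually_mono[OF eventually_ge_at_top[of 1]] le)
  with k show thesis
    by (rule that)
qed

text \<open>Links the threshold \<open>n ^ k\<close> of the Markov estimate to the clock: strict
  monotonicity of the power absorbs the subtracted 1.\<close>

lemma power_le_bound: "k \<ge> 1 \<Longrightarrow> length x ^ k \<le> bound k x"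
proof -
  assume "k \<ge> 1"
  then have "length x ^ k < (length x + 1) ^ k"
    by (intro power_strict_mono) auto
  then show ?thesis
    by (simp add: bound_def)
qed

theorem corollary3p2:
  fixes f :: "bool list \<Rightarrow> bool list"
  assumes "(f, std_uniform) \<in> AvgP"
  shows "\<exists>A. poly_time_algorithm A \<and> frequently_self_knowingly_correct A f"
proof -
  obtain M where M: "computes M f" and avg: "poly_on_average (time M) std_uniform"
    using assms by (auto simp: AvgP_def)
  obtain k where k: "k \<ge> 1"
    and rare: "(\<lambda>n. real (card {x. length x = n \<and> n ^ k < time M x}) / 2 ^ n) \<longlonglongrightarrow> 0"
    using slow_inputs_rare[OF avg] .
  define A where "A = clocked_answer k M f"
  have "poly_time_algorithm A"
    unfolding poly_time_algorithm_def A_def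
    using computes_clocked[OF M] poly_time_clocked[OF M k] by blast
  moreover have "self_knowingly_correct A f"
    by (simp add: self_knowingly_correct_def A_def clocked_answer_def)
  moreover have "(\<lambda>n. real (card {x. length x = n \<and> A x \<in> UNIV \<times> {Maybe}}) /
      real (card {x :: bool list. length x = n})) \<longlonglongrightarrow> 0"
  proof (rule tendsto_sandwich[OF _ _ tendsto_const rare])
    \<comment> \<open>\<open>Maybe\<close> is answered only when the running time exceeds
      \<open>bound k x\<close>, hence also \<open>n ^ k\<close>.\<close>
    have "card {x. length x = n \<and> A x \<in> UNIV \<times> {Maybe}} \<le>
        card {x. length x = n \<and> n ^ k < time M x}" for n
    proof (rule card_mono)
      show "finite {x. length x = n \<and> n ^ k < time M x}"
        by (rule finite_subset[OF _ finite_strings[of n]]) auto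
      show "{x. length x = n \<and> A x \<in> UNIV \<times> {Maybe}} \<subseteq> {x. length x = n \<and> n ^ k < time M x}"
        using power_le_bound[OF k] by (auto simp: A_def clocked_answer_def not_le
          intro: le_less_trans split: if_splits)
    qed
    then show "\<forall>\<^sub>F n in sequentially.
        real (card {x. length x = n \<and> A x \<in> UNIV \<times> {Maybe}}) /
        real (card {x :: bool list. length x = n}) \<le>
        real (card {x. length x = n \<and> n ^ k < time M x}) / 2 ^ n"
      by (simp add: card_strings divide_right_mono)
  qed simp
  ultimately show ?thesis
    by (auto simp: frequently_self_knowingly_correct_def)
qed

end
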